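(* Let $\eta,\eta'\in\Omega^*$. Then $\nu_{\eta}$ and $\nu_{\eta'}$ are strongly singular if and only if $\overline{o}_-(\eta)\cap\overline{o}_-(\eta')=\emptyset$.
   Context: $\mathbb{N}=\{1,2,3,\dots\}$, $\beta\mathbb{N}$ is its Stone–Čech compactification and $\mathbb{N}^*=\beta\mathbb{N}\setminus\mathbb{N}$, whose points are the free ultrafilters on $\mathbb{N}$. Let $\tau:\beta\mathbb{N}\to\beta\mathbb{N}$ be the continuous extension of $n\mapsto n+1$; its restriction to $\mathbb{N}^*$ is a homeomorphism of $\mathbb{N}^*$ onto itself. $\Omega^*$ is the quotient space of $\mathbb{N}^*\times[0,1]$ obtained by identifying $(\omega,1)$ with $(\tau\omega,0)$ for all $\omega\in\mathbb{N}^*$. For $s\in\mathbb{R}$, the homeomorphism $\phi^s:\Omega^*\to\Omega^*$ is $\phi^s(\omega,t)=(\tau^{[t+s]}\omega,\ t+s-[t+s])$, where $[x]$ is the largest integer not exceeding $x$. Put $o_-(\eta)=\{\phi^{-s}(\eta): s\ge 0\}$ and let $\overline{o}_-(\eta)$ be its closure in $\Omega^*$. For $\eta=(\omega,t)\in\Omega^*$, with $\theta=2^t$, $\nu_\eta$ is the finitely additive probability measure on $\mathcal{P}(\mathbb{N})$ given by $\nu_\eta(A)=\omega\text{-}\lim_n \frac{|A\cap\{1,\dots,[\theta\cdot 2^n]\}|}{\theta\cdot 2^n}$, the limit being taken along the ultrafilter $\omega$. Finitely additive probability measures $\mu,\nu$ on $\mathcal{P}(\mathbb{N})$ are strongly singular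 if there is $D\in\mathcal{P}(\mathbb{N})$ with $\mu(D)=0$ and $\nu(D^c)=0$. *)

theory Defs
  imports "HOL-Analysis.Analysis"
begin

text \<open>
  The positive integers are the set \<open>{1..}\<close> of naturals. A point of their Stone--Cech
  compactification is an ultrafilter on that set; it is represented by the filter on \<open>nat\<close> that
  it generates, i.e. by an ultrafilter on \<open>nat\<close> containing \<open>{1..}\<close>. Membership of \<open>A\<close> in the
  ultrafilter \<open>F\<close> is \<open>eventually (\<lambda>n. n \<in> A) F\<close>, and the point \<open>n\<close> is \<open>principal {n}\<close>.
\<close>

definition ultrafilter :: "'a filter \<Rightarrow> bool" where
  "ultrafilter F \<longleftrightarrow> F \<noteq> bot \<and>
     (\<forall>A. eventually (\<lambda>x. x \<in> A) F \<or> eventually (\<lambda>x. x \<notin> A) F)"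

definition beta_points :: "nat filter set" where
  "beta_points = {F. ultrafilter F \<and> eventually (\<lambda>n. n \<in> {1..}) F}"

definition betaN :: "nat filter topology" where
  "betaN = topology_generated_by
     {{F \<in> beta_points. eventually (\<lambda>n. n \<in> A) F} |A. A \<subseteq> {1..}}"

definition Nstar :: "nat filter set" where
  "Nstar = beta_points - (\<lambda>n. principal {n}) ` {1..}"

text \<open>
  The extension of the successor map is the push-forward of ultrafilters; that it is the unique
  continuous extension is shown in \<open>tau_continuous\<close>, \<open>tau_principal\<close> and \<open>tau_unique\<close> below.
\<close>

definition tau :: "nat filter \<Rightarrow> nat filter" where
  "tau F = filtermap Suc F"

definition tau_pow :: "int \<Rightarrow> nat filter \<Rightarrow> nat filter" where
  "tau_pow k = (if 0 \<le> k then tau ^^ nat k else inv_into Nstar tau ^^ nat (- k))"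

definition cylinder :: "(nat filter \<times> real) topology" where
  "cylinder = prod_topology (subtopology betaN Nstar) (top_of_set {0..1})"

definition glue :: "((nat filter \<times> real) \<times> (nat filter \<times> real)) set" where
  "glue = {(p, q). p \<in> Nstar \<times> {0..1} \<and> q \<in> Nstar \<times> {0..1} \<and>
     (p = q \<or> (\<exists>\<omega>. p = (\<omega>, 1) \<and> q = (tau \<omega>, 0)) \<or> (\<exists>\<omega>. q = (\<omega>, 1) \<and> p = (tau \<omega>, 0)))}"

definition Omega_points :: "(nat filter \<times> real) set set" where
  "Omega_points = (Nstar \<times> {0..1}) // glue"

definition pt :: "nat filter \<times> real \<Rightarrow> (nat filter \<times> real) set" where
  "pt p = glue `` {p}"

definition Omega :: "(nat filter \<times> real) set topology" where
  "Omega = topology (\<lambda>W. W \<subseteq> Omega_points \<and> openin cylinder {p \<in> topspace cylinder. pt p \<in> W})"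

text \<open>
  Maps on the quotient are defined by applying a formula to all representatives of a class; that
  the result does not depend on the representative is shown in \<open>phi_pt\<close> and \<open>nu_pt\<close> below.
\<close>

definition phi :: "real \<Rightarrow> (nat filter \<times> real) set \<Rightarrow> (nat filter \<times> real) set" where
  "phi s \<eta> = the_elem ((\<lambda>(\<omega>, t). pt (tau_pow \<lfloor>t + s\<rfloor> \<omega>, t + s - of_int \<lfloor>t + s\<rfloor>)) ` \<eta>)"

definition o_minus :: "(nat filter \<times> real) set \<Rightarrow> (nat filter \<times> real) set set" where
  "o_minus \<eta> = {phi (- s) \<eta> |s. s \<ge> 0}"

definition density_ratio :: "real \<Rightarrow> nat set \<Rightarrow> nat \<Rightarrow> real" where
  "density_ratio \<theta> A n = real (card (A \<inter> {1..nat \<lfloor>\<theta> * 2 ^ n\<rfloor>})) / (\<theta> * 2 ^ n)"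

definition nu :: "(nat filter \<times> real) set \<Rightarrow> nat set \<Rightarrow> real" where
  "nu \<eta> A = the_elem ((\<lambda>(\<omega>, t). Lim \<omega> (density_ratio (2 powr t) A)) ` \<eta>)"

definition fin_add_prob :: "(nat set \<Rightarrow> real) \<Rightarrow> bool" where
  "fin_add_prob \<mu> \<longleftrightarrow> (\<forall>A \<subseteq> {1..}. 0 \<le> \<mu> A) \<and> \<mu> {1..} = 1 \<and>
     (\<forall>A \<subseteq> {1..}. \<forall>B \<subseteq> {1..}. A \<inter> B = {} \<longrightarrow> \<mu> (A \<union> B) = \<mu> A + \<mu> B)"

definition strongly_singular :: "(nat set \<Rightarrow> real) \<Rightarrow> (nat set \<Rightarrow> real) \<Rightarrow> bool" where
  "strongly_singular \<mu> \<nu> \<longleftrightarrow> (\<exists>D \<subseteq> {1..}. \<mu> D = 0 \<and> \<nu> ({1..} - D) = 0)"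


subsection \<open>Ultrafilters and the shift\<close>

lemma ultrafilter_principal: "ultrafilter (principal {n})"
  by (auto simp: ultrafilter_def eventually_principal principal_eq_bot_iff)

lemma principal_in_beta: "n \<ge> 1 \<Longrightarrow> principal {n} \<in> beta_points"
  by (auto simp: beta_points_def ultrafilter_principal eventually_principal)

lemma ultrafilter_eqI:
  assumes F: "ultrafilter F" and G: "ultrafilter G"
    and le: "\<And>A. eventually (\<lambda>x. x \<in> A) F \<Longrightarrow> eventually (\<lambda>x. x \<in> A) G"
  shows "F = G"
proof -
  have "eventually P F \<longleftrightarrow> eventually P G" for P
  proof
    assume "eventually P F"
    then show "eventually P G" using le[of "Collect P"] by simp
  next
    assume P: "eventually P G"
    show "eventually P F"
    proof (rule ccontr)
      assume "\<not> eventually P F"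
      then have "eventually (\<lambda>x. x \<in> - Collect P) F"
        using F unfolding ultrafilter_def by (auto dest: spec[of _ "Collect P"])
      then have "eventually (\<lambda>x. \<not> P x) G" using le by fastforce
      then have "eventually (\<lambda>x. False) G" using P by eventually_elim simp
      then show False using G by (simp add: ultrafilter_def trivial_limit_def)
    qed
  qed
  then show ?thesis by (simp add: filter_eq_iff)
qed

lemma ultrafilter_filtermap: "ultrafilter F \<Longrightarrow> ultrafilter (filtermap f F)"
  unfolding ultrafilter_def eventually_filtermap filtermap_bot_iff
  by (auto dest: spec[of _ "f -` A" for A])

lemma topspace_betaN [simp]: "topspace betaN = beta_points"
proof -
  let ?B = "{{F \<in> beta_points. eventually (\<lambda>n. n \<in> A) F} |A. A \<subseteq> {1..}}"
  have "{F \<in> beta_points. eventually (\<lambda>n. n \<in> {1..}) F} \<in> ?B" by blast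
  moreover have "{F \<in> beta_points. eventually (\<lambda>n. n \<in> {1..}) F} = beta_points"
    by (auto simp: beta_points_def)
  ultimately have "\<Union>?B = beta_points" by blast
  then show ?thesis unfolding betaN_def topology_generated_by_topspace .
qed

lemma openin_betaN_basic:
  "openin betaN {F \<in> beta_points. eventually (\<lambda>n. n \<in> A) F}"
proof -
  have eq: "{F \<in> beta_points. eventually (\<lambda>n. n \<in> A) F}
      = {F \<in> beta_points. eventually (\<lambda>n. n \<in> A \<inter> {1..}) F}"
    by (auto simp: beta_points_def eventually_conj_iff)
  show ?thesis
    unfolding eq betaN_def by (rule topology_generated_by_Basis) blast
qed

lemma Hausdorff_betaN: "Hausdorff_space betaN"
  unfolding Hausdorff_space_def topspace_betaN
proof (intro allI impI)
  fix F G assume *: "F \<in> beta_points \<and> G \<in> beta_points \<and> F \<noteq> G"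
  then obtain A where A: "eventually (\<lambda>n. n \<in> A) F" "\<not> eventually (\<lambda>n. n \<in> A) G"
    using ultrafilter_eqI[of F G] unfolding beta_points_def by blast
  then have B: "eventually (\<lambda>n. n \<in> - A) G"
    using * unfolding beta_points_def ultrafilter_def by auto
  let ?U = "\<lambda>A. {F \<in> beta_points. eventually (\<lambda>n. n \<in> A) F}"
  have "?U A \<inter> ?U (- A) = {}"
  proof (rule equals0I)
    fix H assume "H \<in> ?U A \<inter> ?U (- A)"
    then have H: "H \<noteq> bot" "eventually (\<lambda>n. n \<in> A) H" "eventually (\<lambda>n. n \<in> - A) H"
      by (auto simp: beta_points_def ultrafilter_def)
    from H(2,3) have "eventually (\<lambda>n. False) H" by eventually_elim simp
    then show False using H(1) by (simp add: trivial_limit_def)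
  qed
  then show "\<exists>U V. openin betaN U \<and> openin betaN V \<and> F \<in> U \<and> G \<in> V \<and> disjnt U V"
    using openin_betaN_basic[of A] openin_betaN_basic[of "- A"] A(1) B *
    unfolding disjnt_def by blast
qed

lemma dense_N_betaN: "betaN closure_of ((\<lambda>n. principal {n}) ` {1..}) = topspace betaN"
proof (rule antisym[OF closure_of_subset_topspace], rule subsetI)
  fix F assume "F \<in> topspace betaN"
  then have F: "F \<in> beta_points" by simp
  have gen: "generate_topology_on
      {{F \<in> beta_points. eventually (\<lambda>n. n \<in> A) F} |A. A \<subseteq> {1..}} T \<Longrightarrow>
      G \<in> T \<Longrightarrow> \<exists>A. eventually (\<lambda>n. n \<in> A) G \<and> (\<forall>n\<in>A. n \<ge> 1 \<longrightarrow> principal {n} \<in> T)" for T G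
  proof (induction arbitrary: G rule: generate_topology_on.induct)
    case Empty then show ?case by simp
  next
    case (Int a b)
    obtain A where "eventually (\<lambda>n. n \<in> A) G" "\<forall>n\<in>A. n \<ge> 1 \<longrightarrow> principal {n} \<in> a"
      using Int by blast
    moreover obtain B where "eventually (\<lambda>n. n \<in> B) G" "\<forall>n\<in>B. n \<ge> 1 \<longrightarrow> principal {n} \<in> b"
      using Int by blast
    ultimately show ?case
      by (intro exI[of _ "A \<inter> B"]) (auto simp: eventually_conj_iff)
  next
    case (UN K)
    then show ?case by (meson UnionE UnionI)
  next
    case (Basis s)
    then obtain A where "s = {F \<in> beta_points. eventually (\<lambda>n. n \<in> A) F}" by blast
    with Basis(2) show ?case
      by (intro exI[of _ A]) (auto simp: eventually_principal intro: principal_in_beta)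
  qed
  show "F \<in> betaN closure_of ((\<lambda>n. principal {n}) ` {1..})"
    unfolding in_closure_of
  proof (intro conjI allI impI)
    show "F \<in> topspace betaN" using F by simp
  next
    fix T assume T: "F \<in> T \<and> openin betaN T"
    then obtain A where A: "eventually (\<lambda>n. n \<in> A) F" "\<forall>n\<in>A. n \<ge> 1 \<longrightarrow> principal {n} \<in> T"
      using gen[of T F] unfolding betaN_def openin_topology_generated_by_iff by blast
    have "eventually (\<lambda>n. n \<in> A \<inter> {1..}) F"
      using A(1) F by (auto simp: beta_points_def eventually_conj_iff)
    moreover have "F \<noteq> bot" using F by (simp add: beta_points_def ultrafilter_def)
    ultimately obtain n where "n \<in> A \<inter> {1..}" by (metis eventually_happens')
    then show "\<exists>y. y \<in> (\<lambda>n. principal {n}) ` {1..} \<and> y \<in> T" using A(2) by auto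
  qed
qed

lemma tau_in_beta: "F \<in> beta_points \<Longrightarrow> tau F \<in> beta_points"
  by (auto simp: beta_points_def tau_def ultrafilter_filtermap eventually_filtermap)

lemma tau_principal: "tau (principal {n}) = principal {n + 1}"
  by (simp add: tau_def filtermap_principal)

lemma tau_continuous: "continuous_map betaN betaN tau"
  apply (subst (2) betaN_def, rule continuous_on_generated_topo)
  subgoal for U
  proof -
    assume "U \<in> {{F \<in> beta_points. eventually (\<lambda>n. n \<in> A) F} |A. A \<subseteq> {1..}}"
    then obtain A where "U = {F \<in> beta_points. eventually (\<lambda>n. n \<in> A) F}" by blast
    then have "tau -` U \<inter> topspace betaN
        = {F \<in> beta_points. eventually (\<lambda>n. n \<in> Suc -` A) F}"
      using tau_in_beta by (auto simp: tau_def eventually_filtermap)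
    then show "openin betaN (tau -` U \<inter> topspace betaN)"
      using openin_betaN_basic[of "Suc -` A"] by (simp only:)
  qed
  subgoal
    unfolding betaN_def[symmetric] topology_generated_by_topspace[symmetric]
    using tau_in_beta by auto
  done

lemma tau_unique:
  assumes "continuous_map betaN betaN f" "\<And>n. n \<ge> 1 \<Longrightarrow> f (principal {n}) = principal {n + 1}"
    and "F \<in> beta_points"
  shows "f F = tau F"
proof (rule forall_in_closure_of_eq[where f = f and g = tau and x = F])
  show "F \<in> betaN closure_of ((\<lambda>n. principal {n}) ` {1..})"
    unfolding dense_N_betaN using assms(3) by simp
qed (use assms tau_continuous tau_principal Hausdorff_betaN in auto)

lemma Nstar_eventually_neq:
  assumes F: "F \<in> Nstar" shows "eventually (\<lambda>n. n \<noteq> m) F"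
proof (rule ccontr)
  assume "\<not> eventually (\<lambda>n. n \<noteq> m) F"
  then have ev: "eventually (\<lambda>n. n = m) F"
    using F unfolding Nstar_def beta_points_def ultrafilter_def
    by (auto dest: spec[of _ "{m}"])
  have uf: "ultrafilter F" "F \<noteq> bot" "eventually (\<lambda>n. n \<ge> 1) F"
    using F by (auto simp: Nstar_def beta_points_def ultrafilter_def)
  have "principal {m} = F"
  proof (rule ultrafilter_eqI[OF ultrafilter_principal uf(1)])
    fix A assume "eventually (\<lambda>x. x \<in> A) (principal {m})"
    then have "m \<in> A" by (simp add: eventually_principal)
    with ev show "eventually (\<lambda>x. x \<in> A) F" by (auto elim: eventually_mono)
  qed
  moreover have "m \<ge> 1"
    using eventually_happens'[OF uf(2) eventually_conj[OF ev uf(3)]] by auto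
  ultimately show False using F by (auto simp: Nstar_def)
qed

lemma Nstar_le_sequentially:
  assumes "F \<in> Nstar" shows "F \<le> sequentially"
proof (rule filter_leI)
  fix P :: "nat \<Rightarrow> bool" assume "eventually P sequentially"
  then obtain N where N: "\<And>n. n \<ge> N \<Longrightarrow> P n" by (auto simp: eventually_sequentially)
  have "eventually (\<lambda>n. \<forall>m\<in>{..<N}. n \<noteq> m) F"
    by (intro eventually_ball_finite ballI Nstar_eventually_neq assms) simp
  then show "eventually P F"
    by eventually_elim (metis N lessThan_iff not_le)
qed

lemma tau_bij: "bij_betw tau Nstar Nstar"
  unfolding bij_betw_def
proof
  show inj: "inj_on tau Nstar"
    by (auto simp: inj_on_def tau_def filtermap_eq_strong)
  show "tau ` Nstar = Nstar"
  proof (intro equalityI subsetI)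
    fix G assume "G \<in> tau ` Nstar"
    then obtain F where F: "F \<in> Nstar" "G = tau F" by blast
    have "G \<noteq> principal {n}" for n
    proof
      assume "G = principal {n}"
      then have "eventually (\<lambda>m. Suc m = n) F"
        using F(2) unfolding tau_def filter_eq_iff eventually_filtermap eventually_principal
        by (auto dest: spec[of _ "\<lambda>m. m = n"])
      moreover have "eventually (\<lambda>m. m \<noteq> n - 1) F" by (rule Nstar_eventually_neq[OF F(1)])
      ultimately have "eventually (\<lambda>m. False) F" by eventually_elim auto
      then show False using F(1)
        by (simp add: Nstar_def beta_points_def ultrafilter_def trivial_limit_def)
    qed
    then show "G \<in> Nstar" using F tau_in_beta by (auto simp: Nstar_def)
  next
    fix G assume G: "G \<in> Nstar"
    define F where "F = filtermap (\<lambda>n. n - 1) G"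
    have "eventually (\<lambda>n. n \<noteq> 0) G" "eventually (\<lambda>n. n \<noteq> 1) G"
      using Nstar_eventually_neq[OF G] by blast+
    then have "eventually (\<lambda>n. n - 1 \<ge> 1) G" by eventually_elim simp
    moreover have "ultrafilter F"
      using G by (simp add: F_def Nstar_def beta_points_def ultrafilter_filtermap)
    ultimately have Fb: "F \<in> beta_points"
      by (simp add: beta_points_def F_def eventually_filtermap)
    have "tau F = filtermap (\<lambda>n. Suc (n - 1)) G"
      by (simp add: tau_def F_def filtermap_filtermap)
    also have "\<dots> = filtermap (\<lambda>n. n) G"
    proof -
      have "eventually (\<lambda>n. P (Suc (n - 1)) \<longleftrightarrow> P n) G" for P
        using \<open>eventually (\<lambda>n. n \<noteq> 0) G\<close> by eventually_elim simp
      then show ?thesis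
        unfolding filter_eq_iff eventually_filtermap using eventually_subst by metis
    qed
    finally have tF: "tau F = G" by (simp add: filtermap_ident)
    have "F \<in> Nstar"
      using Fb tF G by (auto simp: Nstar_def tau_principal)
    then show "G \<in> tau ` Nstar" using tF by blast
  qed
qed

lemma tau_in_Nstar: "\<omega> \<in> Nstar \<Longrightarrow> tau \<omega> \<in> Nstar"
  using tau_bij by (auto simp: bij_betw_def)

lemma tau_pow_tau:
  assumes "\<omega> \<in> Nstar" shows "tau_pow k (tau \<omega>) = tau_pow (k + 1) \<omega>"
proof (cases "k \<ge> 0")
  case True
  then have "nat (k + 1) = Suc (nat k)" by simp
  then show ?thesis using True by (simp add: tau_pow_def funpow_swap1)
next
  case False
  have inv: "inv_into Nstar tau (tau \<omega>) = \<omega>"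
    using assms tau_bij by (simp add: bij_betw_def)
  have "nat (- k) = Suc (nat (- (k + 1)))" using False by simp
  then have "tau_pow k (tau \<omega>) = (inv_into Nstar tau ^^ nat (- (k + 1))) \<omega>"
    using False by (simp add: tau_pow_def funpow_Suc_right inv del: funpow.simps)
  also have "\<dots> = tau_pow (k + 1) \<omega>"
    using False by (cases "k = -1") (auto simp: tau_pow_def)
  finally show ?thesis .
qed


subsection \<open>The quotient space\<close>

lemma topspace_cylinder: "topspace cylinder = Nstar \<times> {0..1}"
  by (auto simp: cylinder_def Nstar_def)

lemma glue_equiv: "equiv (Nstar \<times> {0..1}) glue"
proof (rule equivI)
  show "refl_on (Nstar \<times> {0..1}) glue" by (auto simp: refl_on_def glue_def)
  show "glue \<subseteq> (Nstar \<times> {0..1}) \<times> (Nstar \<times> {0..1})" by (auto simp: glue_def)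
  show "sym glue" by (auto simp: sym_def glue_def)
  have inj: "a = b" if "tau a = tau b" "a \<in> Nstar" "b \<in> Nstar" for a b
    using tau_bij that by (auto simp: bij_betw_def dest: inj_onD)
  show "trans glue" by (rule transI) (auto simp: glue_def dest: inj)
qed

lemma pt_glued: "\<omega> \<in> Nstar \<Longrightarrow> pt (\<omega>, 1) = pt (tau \<omega>, 0)"
  unfolding pt_def by (rule equiv_class_eq[OF glue_equiv]) (simp add: glue_def tau_in_Nstar)

lemma pt_const:
  assumes p: "p \<in> Nstar \<times> {0..1}"
    and f: "\<And>\<omega>. \<omega> \<in> Nstar \<Longrightarrow> f (\<omega>, 1) = f (tau \<omega>, 0)"
  shows "the_elem (f ` pt p) = f p"
proof -
  have "f q = f p" if "q \<in> pt p" for q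
    using that f by (auto simp: pt_def glue_def)
  moreover have "p \<in> pt p" unfolding pt_def by (rule equiv_class_self[OF glue_equiv p])
  ultimately have "f ` pt p = {f p}" by blast
  then show ?thesis by simp
qed

lemma openin_Omega:
  "openin Omega W \<longleftrightarrow> W \<subseteq> Omega_points \<and> openin cylinder {p \<in> topspace cylinder. pt p \<in> W}"
proof -
  let ?V = "\<lambda>W. {p \<in> topspace cylinder. pt p \<in> W}"
  have "istopology (\<lambda>W. W \<subseteq> Omega_points \<and> openin cylinder (?V W))"
    unfolding istopology_def
  proof (intro conjI allI impI)
    fix S T assume "S \<subseteq> Omega_points \<and> openin cylinder (?V S)"
      "T \<subseteq> Omega_points \<and> openin cylinder (?V T)"
    moreover have "?V (S \<inter> T) = ?V S \<inter> ?V T" by blast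
    ultimately show "S \<inter> T \<subseteq> Omega_points" "openin cylinder (?V (S \<inter> T))" by auto
  next
    fix K assume K: "\<forall>S\<in>K. S \<subseteq> Omega_points \<and> openin cylinder (?V S)"
    then show "\<Union>K \<subseteq> Omega_points" by blast
    have "?V (\<Union>K) = (\<Union>S\<in>K. ?V S)" by blast
    then show "openin cylinder (?V (\<Union>K))" using K by auto
  qed
  then show ?thesis unfolding Omega_def by simp
qed

lemma topspace_Omega: "topspace Omega = Omega_points"
proof -
  have "pt p \<in> Omega_points" if "p \<in> topspace cylinder" for p
    using that unfolding Omega_points_def pt_def topspace_cylinder by (rule quotientI)
  then have "{p \<in> topspace cylinder. pt p \<in> Omega_points} = topspace cylinder" by blast
  then have "openin Omega Omega_points" by (simp add: openin_Omega)
  then show ?thesis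
    by (meson openin_Omega openin_subset openin_topspace subset_antisym)
qed

lemma pt_quotient_map: "quotient_map cylinder Omega pt"
  unfolding quotient_map_def openin_Omega topspace_Omega
  by (auto simp: Omega_points_def quotient_def pt_def topspace_cylinder)

lemma phi_pt:
  assumes "\<omega> \<in> Nstar" "t \<in> {0..1}"
  shows "phi s (pt (\<omega>, t)) = pt (tau_pow \<lfloor>t + s\<rfloor> \<omega>, t + s - of_int \<lfloor>t + s\<rfloor>)"
proof -
  have "\<lfloor>1 + s\<rfloor> = \<lfloor>s\<rfloor> + 1" by linarith
  then show ?thesis unfolding phi_def
    by (subst pt_const) (use assms in \<open>auto simp: tau_pow_tau add.commute\<close>)
qed


subsection \<open>The measures\<close>

lemma ultrafilter_tendsto:
  fixes f :: "'a \<Rightarrow> real"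
  assumes F: "ultrafilter F" and f: "\<And>x. f x \<in> {a..b}"
  shows "\<exists>l. (f \<longlongrightarrow> l) F"
proof -
  let ?G = "filtermap f F"
  have G: "ultrafilter ?G" by (rule ultrafilter_filtermap[OF F])
  have "compact {a..b}" by simp
  then obtain l where l: "inf (nhds l) ?G \<noteq> bot"
    unfolding compact_filter
    using G f by (auto simp: ultrafilter_def eventually_filtermap)
  have "(f \<longlongrightarrow> l) F"
  proof (rule topological_tendstoI, rule ccontr)
    fix S assume S: "open S" "l \<in> S" "\<not> eventually (\<lambda>x. f x \<in> S) F"
    then have "eventually (\<lambda>y. y \<notin> S) ?G"
      using G unfolding ultrafilter_def by (auto simp: eventually_filtermap)
    moreover have "eventually (\<lambda>y. y \<in> S) (nhds l)"
      using S by (simp add: eventually_nhds_in_open)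
    ultimately have "eventually (\<lambda>y. False) (inf (nhds l) ?G)"
      unfolding eventually_inf by fastforce
    then show False using l by (simp add: trivial_limit_def)
  qed
  then show ?thesis ..
qed

lemma density_ratio_bounds:
  assumes "\<theta> > 0" shows "density_ratio \<theta> A n \<in> {0..1}"
proof -
  have "card (A \<inter> {1..nat \<lfloor>\<theta> * 2 ^ n\<rfloor>}) \<le> card {1..nat \<lfloor>\<theta> * 2 ^ n\<rfloor>}"
    by (rule card_mono) auto
  moreover have "real (nat \<lfloor>\<theta> * 2 ^ n\<rfloor>) \<le> \<theta> * 2 ^ n" using assms by simp
  ultimately have "real (card (A \<inter> {1..nat \<lfloor>\<theta> * 2 ^ n\<rfloor>})) \<le> \<theta> * 2 ^ n" by simp
  then show ?thesis using assms by (simp add: density_ratio_def)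
qed

lemma density_ratio_tendsto:
  assumes "\<omega> \<in> Nstar" "\<theta> > 0"
  shows "(density_ratio \<theta> A \<longlongrightarrow> Lim \<omega> (density_ratio \<theta> A)) \<omega>"
proof -
  have uf: "ultrafilter \<omega>" "\<omega> \<noteq> bot"
    using assms by (auto simp: Nstar_def beta_points_def ultrafilter_def)
  obtain l where "(density_ratio \<theta> A \<longlongrightarrow> l) \<omega>"
    using ultrafilter_tendsto[of \<omega> "density_ratio \<theta> A" 0 1, OF uf(1) density_ratio_bounds[OF assms(2)]] by blast
  then show ?thesis using tendsto_Lim[OF uf(2), of "density_ratio \<theta> A" l] by simp
qed

lemma nu_pt:
  assumes "\<omega> \<in> Nstar" "t \<in> {0..1}"
  shows "nu (pt (\<omega>, t)) A = Lim \<omega> (density_ratio (2 powr t) A)"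
proof -
  have "Lim \<omega> (density_ratio 2 A) = Lim (tau \<omega>) (density_ratio 1 A)" for \<omega>
  proof -
    have "density_ratio 2 A = (\<lambda>n. density_ratio 1 A (Suc n))"
      by (simp add: density_ratio_def fun_eq_iff)
    then show ?thesis by (simp add: t2_space_class.Lim_def tau_def filterlim_filtermap)
  qed
  then show ?thesis unfolding nu_def
    by (subst pt_const) (use assms in auto)
qed

lemma nu_fin_add_prob:
  assumes "\<eta> \<in> topspace Omega" shows "fin_add_prob (nu \<eta>)"
proof -
  obtain \<omega> t where wt: "\<omega> \<in> Nstar" "t \<in> {0..1}" "\<eta> = pt (\<omega>, t)"
    using assms unfolding topspace_Omega Omega_points_def pt_def by (auto elim!: quotientE)
  define \<theta> :: real where "\<theta> = 2 powr t"
  have th: "\<theta> > 0" by (simp add: \<theta>_def)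
  have bot: "\<omega> \<noteq> bot" using wt by (auto simp: Nstar_def beta_points_def ultrafilter_def)
  have lim: "(density_ratio \<theta> A \<longlongrightarrow> nu \<eta> A) \<omega>" for A
    using density_ratio_tendsto[OF wt(1) th] nu_pt[OF wt(1,2)] by (simp add: wt(3) \<theta>_def)
  have "0 \<le> nu \<eta> A" for A
    by (rule tendsto_lowerbound[OF lim _ bot]) (use density_ratio_bounds[OF th] in auto)
  moreover have "nu \<eta> {1..} = 1"
  proof -
    have low: "1 - inverse \<theta> * (1/2) ^ n \<le> density_ratio \<theta> {1..} n" for n
    proof -
      have "real (nat \<lfloor>\<theta> * 2 ^ n\<rfloor>) \<ge> \<theta> * 2 ^ n - 1" by linarith
      then have "(\<theta> * 2 ^ n - 1) / (\<theta> * 2 ^ n) \<le> density_ratio \<theta> {1..} n"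
        using th by (simp add: density_ratio_def divide_right_mono Int_absorb1)
      moreover have "(\<theta> * 2 ^ n - 1) / (\<theta> * 2 ^ n) = 1 - inverse \<theta> * (1/2) ^ n"
        using th by (simp add: field_simps)
      ultimately show ?thesis by simp
    qed
    have "(\<lambda>n. 1 - inverse \<theta> * (1/2) ^ n) \<longlonglongrightarrow> 1 - inverse \<theta> * 0"
      by (intro tendsto_intros LIMSEQ_power_zero) simp
    then have "(\<lambda>n. 1 - inverse \<theta> * (1/2) ^ n) \<longlonglongrightarrow> 1" by simp
    then have "density_ratio \<theta> {1..} \<longlonglongrightarrow> 1"
      by (rule tendsto_sandwich[where h = "\<lambda>_. 1", rotated 2])
        (use low density_ratio_bounds[OF th] in auto)
    then have "(density_ratio \<theta> {1..} \<longlongrightarrow> 1) \<omega>"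
      using Nstar_le_sequentially[OF wt(1)] by (rule tendsto_mono[rotated])
    then show ?thesis using tendsto_unique[OF bot lim] by blast
  qed
  moreover have "nu \<eta> (A \<union> B) = nu \<eta> A + nu \<eta> B" if "A \<inter> B = {}" for A B
  proof -
    have "density_ratio \<theta> (A \<union> B) n = density_ratio \<theta> A n + density_ratio \<theta> B n" for n
      using that by (simp add: density_ratio_def Int_Un_distrib2 add_divide_distrib[symmetric])
        (subst card_Un_disjoint, auto)
    then have "density_ratio \<theta> (A \<union> B) = (\<lambda>n. density_ratio \<theta> A n + density_ratio \<theta> B n)" by blast
    then have "(density_ratio \<theta> (A \<union> B) \<longlongrightarrow> nu \<eta> A + nu \<eta> B) \<omega>"
      using tendsto_add[OF lim lim] by simp
    then show ?thesis using tendsto_unique[OF bot lim] by blast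
  qed
  ultimately show ?thesis by (simp add: fin_add_prob_def)
qed

end

theory Submission
  imports Defs
begin

text \<open>
  Read \<open>(\<omega>, t)\<close> as the position \<open>n + t\<close> on the logarithmic scale, \<open>n\<close> tending to infinity
  along \<open>\<omega>\<close>. Mass at distance \<open>k\<close> below the position contributes at most \<open>2\<^sup>-\<^sup>k\<close> to \<open>\<nu>\<close>, so
  \<open>\<nu>\<close> is governed by the windows \<open>(n + t - k, n + t]\<close>, which also describe the backward orbit.
  The vanishing of \<open>\<nu>(D)\<close> is preserved by the backward flow and is a closed condition; a common
  point of the two orbit closures would thus give mass 0 to both \<open>D\<close> and its complement.
  Conversely, let \<open>tail_filter \<omega> t\<close> be the filter of sets containing almost all windows of
  every length. If the two tail filters contain disjoint sets, these witness strong singularity.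
  Otherwise there is an ultrafilter \<open>H\<close> finer than both, and the integer and fractional parts of
  \<open>log\<^sub>2\<close> along \<open>H\<close> determine a point of both orbit closures.
\<close>

subsection \<open>Ultrafilters\<close>

text \<open>Zorn's lemma: a finest proper filter below \<open>F\<close> decides every set.\<close>

lemma ultrafilter_exists:
  fixes F :: "'a filter"
  assumes "F \<noteq> bot"
  shows "\<exists>H\<le>F. ultrafilter H"
proof -
  \<comment> \<open>The order is reversed: upper bounds are finer filters, and a maximal element is
    a minimal proper filter.\<close>
  let ?r = "{(G :: 'a filter, H). G \<noteq> bot \<and> H \<noteq> bot \<and> H \<le> G \<and> G \<le> F}"
  have field: "Field ?r = {G. G \<noteq> bot \<and> G \<le> F}"
    by (auto simp: Field_def)
  have po: "Partial_order ?r"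
    unfolding order_on_defs field
    by (auto simp: refl_on_def trans_def antisym_def)
  have "\<exists>m\<in>Field ?r. \<forall>a\<in>Field ?r. (m, a) \<in> ?r \<longrightarrow> a = m"
  proof (rule Zorns_po_lemma[OF po])
    fix C assume C: "C \<in> Chains ?r"
    show "\<exists>u\<in>Field ?r. \<forall>a\<in>C. (a, u) \<in> ?r"
    proof (cases "C = {}")
      case True
      then show ?thesis using assms by (auto simp: field)
    next
      case False
      have sub: "\<And>G. G \<in> C \<Longrightarrow> G \<noteq> bot \<and> G \<le> F" and
        chain: "\<And>G H. G \<in> C \<Longrightarrow> H \<in> C \<Longrightarrow> G \<le> H \<or> H \<le> G"
        using C by (auto simp: Chains_def)
      \<comment> \<open>For a chain, whatever holds eventually in the infimum already holds
        eventually in one member, so the infimum of proper filters is proper.\<close>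
      have "eventually (\<lambda>x. False) (Inf C) \<longleftrightarrow> (\<exists>b\<in>C. eventually (\<lambda>x. False) b)"
        by (rule eventually_Inf_base[OF False])
          (metis chain inf.absorb1 inf.absorb2 order_refl)
      then have "Inf C \<noteq> bot"
        using sub by (auto simp: trivial_limit_def)
      moreover have "Inf C \<le> F"
        using False sub by (meson Inf_lower2 ex_in_conv)
      ultimately show ?thesis
        using sub by (intro bexI[of _ "Inf C"]) (auto simp: field Inf_lower)
    qed
  qed
  then obtain H where H: "H \<noteq> bot" "H \<le> F"
    and max: "\<And>G. G \<noteq> bot \<Longrightarrow> G \<le> H \<Longrightarrow> G = H"
    unfolding field by (auto 0 4)
  have "eventually (\<lambda>x. x \<in> A) H \<or> eventually (\<lambda>x. x \<notin> A) H" for A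
  proof (rule disjCI)
    assume "\<not> eventually (\<lambda>x. x \<notin> A) H"
    \<comment> \<open>The trace of \<open>H\<close> on \<open>A\<close> is proper because the
      complement of \<open>A\<close> is not in \<open>H\<close>; minimality makes it equal to
      \<open>H\<close>.\<close>
    then have "inf H (principal A) \<noteq> bot"
      by (auto simp: trivial_limit_def eventually_inf_principal)
    then have "inf H (principal A) = H" by (rule max) simp
    moreover have "eventually (\<lambda>x. x \<in> A) (inf H (principal A))"
      by (simp add: eventually_inf_principal)
    ultimately show "eventually (\<lambda>x. x \<in> A) H" by simp
  qed
  then show ?thesis using H by (auto simp: ultrafilter_def)
qed

lemma ultrafilter_not_eventually:
  assumes "ultrafilter F" "\<not> eventually P F"
  shows "eventually (\<lambda>x. \<not> P x) F"
  using assms unfolding ultrafilter_def by (auto dest: spec[of _ "Collect P"])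

lemma Nstar_ultrafilter: "\<omega> \<in> Nstar \<Longrightarrow> ultrafilter \<omega>"
  by (simp add: Nstar_def beta_points_def)

lemma Nstar_neq_bot: "\<omega> \<in> Nstar \<Longrightarrow> \<omega> \<noteq> bot"
  using Nstar_ultrafilter by (auto simp: ultrafilter_def)

lemma Nstar_eventually_ge: "\<omega> \<in> Nstar \<Longrightarrow> eventually (\<lambda>n. n \<ge> N) \<omega>"
  using Nstar_le_sequentially filter_leD eventually_ge_at_top by blast

lemma Nstar_iff: "\<omega> \<in> Nstar \<longleftrightarrow> ultrafilter \<omega> \<and> \<omega> \<le> sequentially"
proof
  assume *: "ultrafilter \<omega> \<and> \<omega> \<le> sequentially"
  have "\<omega> \<noteq> principal {n}" for n
  proof
    assume "\<omega> = principal {n}"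
    moreover have "eventually (\<lambda>m. m > n) \<omega>"
      using * filter_leD eventually_gt_at_top by blast
    ultimately show False by (simp add: eventually_principal)
  qed
  moreover have "eventually (\<lambda>n. 1 \<le> n) \<omega>"
    using * filter_leD eventually_ge_at_top by blast
  ultimately show "\<omega> \<in> Nstar" using * by (auto simp: Nstar_def beta_points_def)
qed (use Nstar_ultrafilter Nstar_le_sequentially in auto)

text \<open>The generating sets of \<open>betaN\<close> are stable under intersection up to
  containment, so they form a base: a neighbourhood can be described by a single set
  \<open>A\<close> of naturals.\<close>

lemma openin_betaN_neighbourhood:
  assumes "openin betaN T" "G \<in> T"
  shows "\<exists>A. eventually (\<lambda>n. n \<in> A) G \<and> (\<forall>F\<in>beta_points. eventually (\<lambda>n. n \<in> A) F \<longrightarrow> F \<in> T)"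
proof -
  have "generate_topology_on {{F \<in> beta_points. eventually (\<lambda>n. n \<in> A) F} |A. A \<subseteq> {1..}} T"
    using assms unfolding betaN_def openin_topology_generated_by_iff by blast
  then show ?thesis using assms(2)
  proof (induction arbitrary: G rule: generate_topology_on.induct)
    case Empty then show ?case by simp
  next
    case (Int a b)
    obtain A where "eventually (\<lambda>n. n \<in> A) G"
      "\<forall>F\<in>beta_points. eventually (\<lambda>n. n \<in> A) F \<longrightarrow> F \<in> a"
      using Int by blast
    moreover obtain B where "eventually (\<lambda>n. n \<in> B) G"
      "\<forall>F\<in>beta_points. eventually (\<lambda>n. n \<in> B) F \<longrightarrow> F \<in> b"
      using Int by blast
    ultimately show ?case
      by (intro exI[of _ "A \<inter> B"]) (auto simp: eventually_conj_iff)
  next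
    case (UN K)
    then show ?case by (meson UnionE UnionI)
  next
    case (Basis s)
    then show ?case by blast
  qed
qed

section \<open>Integer powers of the shift as push-forwards\<close>

lemma tau_funpow: "(tau ^^ m) F = filtermap (\<lambda>n. n + m) F"
  by (induction m) (simp_all add: filtermap_ident tau_def filtermap_filtermap)

text \<open>Replaces the inverse branch of \<open>tau_pow\<close> by an explicit translation, so
  that one formula serves both signs of \<open>k\<close>. Truncation by \<open>nat\<close> affects
  only finitely many \<open>n\<close>, which a free ultrafilter ignores.\<close>

lemma tau_pow_Nstar:
  assumes \<omega>: "\<omega> \<in> Nstar"
  shows "tau_pow k \<omega> \<in> Nstar"
    and "tau_pow k \<omega> = filtermap (\<lambda>n. nat (int n + k)) \<omega>"
proof -
  have neg: "(inv_into Nstar tau ^^ m) \<omega> \<in> Nstar \<and> (tau ^^ m) ((inv_into Nstar tau ^^ m) \<omega>) = \<omega>" for m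
  proof (induction m)
    case 0
    then show ?case using \<omega> by simp
  next
    case (Suc m)
    have im: "tau ` Nstar = Nstar" using tau_bij by (simp add: bij_betw_def)
    show ?case
      using Suc inv_into_into[of _ tau Nstar] f_inv_into_f[of _ tau Nstar]
      by (simp add: im funpow_Suc_right del: funpow.simps(2))
        (simp add: funpow_swap1[symmetric] im flip: funpow_swap1)
  qed
  have "tau_pow k \<omega> \<in> Nstar \<and> tau_pow k \<omega> = filtermap (\<lambda>n. nat (int n + k)) \<omega>"
  proof (cases "0 \<le> k")
    case True
    have "(tau ^^ m) \<omega> \<in> Nstar" for m
      by (induction m) (use \<omega> tau_in_Nstar in auto)
    moreover have "(\<lambda>n. n + nat k) = (\<lambda>n. nat (int n + k))"
      using True by (auto simp: fun_eq_iff)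
    ultimately show ?thesis using True by (metis tau_funpow tau_pow_def)
  next
    case False
    define F where "F = (inv_into Nstar tau ^^ nat (- k)) \<omega>"
    have F: "F \<in> Nstar" "filtermap (\<lambda>n. n + nat (- k)) F = \<omega>"
      using neg[of "nat (- k)"] by (auto simp: F_def tau_funpow)
    \<comment> \<open>Written as a forward shift of \<open>F\<close>, \<omega> lives on indices at
      which adding the negative \<open>k\<close> does not truncate.\<close>
    have "filtermap (\<lambda>n. nat (int n + k)) \<omega> = filtermap (\<lambda>n. nat (int (n + nat (- k)) + k)) F"
      by (simp add: F(2)[symmetric] filtermap_filtermap)
    also have "\<dots> = F" using False by (simp add: filtermap_ident)
    finally show ?thesis using F(1) False by (simp add: tau_pow_def F_def)
  qed
  then show "tau_pow k \<omega> \<in> Nstar" "tau_pow k \<omega> = filtermap (\<lambda>n. nat (int n + k)) \<omega>" by auto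
qed

lemma eventually_tau_pow:
  "\<omega> \<in> Nstar \<Longrightarrow> eventually P (tau_pow k \<omega>) \<longleftrightarrow> eventually (\<lambda>n. P (nat (int n + k))) \<omega>"
  by (simp add: tau_pow_Nstar(2) eventually_filtermap)


subsection \<open>Null sets and the flow\<close>

lemma topspace_Omega_pt:
  assumes "\<eta> \<in> topspace Omega"
  obtains \<omega> t where "\<omega> \<in> Nstar" "t \<in> {0..1}" "\<eta> = pt (\<omega>, t)"
  using assms unfolding topspace_Omega Omega_points_def pt_def by (auto elim!: quotientE)

lemma pt_in_topspace_Omega: "\<omega> \<in> Nstar \<Longrightarrow> t \<in> {0..1} \<Longrightarrow> pt (\<omega>, t) \<in> topspace Omega"
  unfolding topspace_Omega Omega_points_def pt_def by (auto intro: quotientI)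

lemma nu_tendsto:
  assumes "\<omega> \<in> Nstar" "t \<in> {0..1}"
  shows "(density_ratio (2 powr t) A \<longlongrightarrow> nu (pt (\<omega>, t)) A) \<omega>"
  using density_ratio_tendsto[OF assms(1), of "2 powr t" A] by (simp add: nu_pt[OF assms])

text \<open>Flowing back by \<open>s\<close> shortens the initial segment and divides the normaliser
  by \<open>2 powr s\<close>, so the density ratio grows by at most that factor.\<close>

lemma nu_phi_null:
  assumes \<omega>: "\<omega> \<in> Nstar" and t: "t \<in> {0..1}" and s: "0 \<le> s" and null: "nu (pt (\<omega>, t)) D = 0"
  shows "nu (phi (- s) (pt (\<omega>, t))) D = 0"
proof -
  define j where "j = \<lfloor>t - s\<rfloor>"
  define u where "u = t - s - j"
  have u: "u \<in> {0..1}" unfolding u_def j_def by simp linarith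
  have phi: "phi (- s) (pt (\<omega>, t)) = pt (tau_pow j \<omega>, u)"
    using phi_pt[OF \<omega> t, of "- s"] by (simp add: j_def u_def)
  have "(density_ratio (2 powr u) D \<longlongrightarrow> nu (pt (tau_pow j \<omega>, u)) D) (tau_pow j \<omega>)"
    by (rule nu_tendsto[OF tau_pow_Nstar(1)[OF \<omega>] u])
  then have lim: "((\<lambda>n. density_ratio (2 powr u) D (nat (int n + j)))
      \<longlongrightarrow> nu (pt (tau_pow j \<omega>, u)) D) \<omega>"
    by (simp add: tau_pow_Nstar(2)[OF \<omega>] filterlim_filtermap)
  have le: "density_ratio (2 powr u) D (nat (int n + j)) \<le> 2 powr s * density_ratio (2 powr t) D n"
    \<comment> \<open>Beyond this index \<open>nat (int n + j)\<close> does not truncate, and the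
      new cutoff is exactly \<open>2 powr (n + t - s)\<close>.\<close>
    if n: "n \<ge> nat (- j)" for n
  proof -
    have pow: "2 powr u * 2 ^ nat (int n + j) = (2::real) powr (real n + t - s)"
    proof -
      have "(2::real) ^ nat (int n + j) = 2 powr real (nat (int n + j))"
        by (simp add: powr_realpow)
      also have "real (nat (int n + j)) = real n + real_of_int j" using n by simp
      finally show ?thesis by (simp add: u_def algebra_simps flip: powr_add)
    qed
    have pow': "2 powr t * 2 ^ n = (2::real) powr (real n + t - s) * 2 powr s"
      by (simp add: powr_add[symmetric] powr_realpow[symmetric] add.commute)
    have "(2::real) powr (real n + t - s) * 1 \<le> 2 powr (real n + t - s) * 2 powr s"
      by (rule mult_left_mono) (use s in \<open>auto intro: ge_one_powr_ge_zero\<close>)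
    then have "card (D \<inter> {1..nat \<lfloor>(2::real) powr (real n + t - s)\<rfloor>})
        \<le> card (D \<inter> {1..nat \<lfloor>2 powr (real n + t - s) * 2 powr s\<rfloor>})"
      by (intro card_mono) (auto intro!: nat_mono floor_mono order_trans[of _ "nat \<lfloor>(2::real) powr (real n + t - s)\<rfloor>"])
    then show ?thesis
      unfolding density_ratio_def pow pow' by (simp add: field_simps)
  qed
  have "((\<lambda>n. 2 powr s * density_ratio (2 powr t) D n) \<longlongrightarrow> 2 powr s * 0) \<omega>"
    using nu_tendsto[OF \<omega> t, of D] unfolding null by (intro tendsto_intros)
  then have "nu (pt (tau_pow j \<omega>, u)) D \<le> 0"
    using tendsto_le[OF Nstar_neq_bot[OF \<omega>] _ lim]
      eventually_mono[OF Nstar_eventually_ge[OF \<omega>] le] by simp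
  moreover have "0 \<le> nu (pt (tau_pow j \<omega>, u)) D"
    by (rule tendsto_lowerbound[OF lim _ Nstar_neq_bot[OF \<omega>]])
      (use density_ratio_bounds[of "2 powr u"] in auto)
  ultimately show ?thesis unfolding phi by simp
qed

section \<open>Closedness of the null condition\<close>

text \<open>Passing from one cutoff to the other loses at most the integers between them, with 1 to
  spare for the floors; the normalisers differ by a factor of at most 2. The bound is uniform in
  \<open>D\<close> and \<open>n\<close>, so the ultrafilter and the parameter can vary
  together.\<close>

lemma density_ratio_perturb:
  assumes \<theta>: "\<theta> \<in> {1..2}" and \<theta>': "\<theta>' \<in> {1..2}"
  shows "density_ratio \<theta> D n / 2 - \<bar>\<theta> - \<theta>'\<bar> - 1 / 2 ^ n \<le> density_ratio \<theta>' D n"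
proof -
  define a where "a = real (card (D \<inter> {1..nat \<lfloor>\<theta> * 2 ^ n\<rfloor>}))"
  define b where "b = real (card (D \<inter> {1..nat \<lfloor>\<theta>' * 2 ^ n\<rfloor>}))"
  define p :: real where "p = 2 ^ n"
  have p: "p > 0" by (simp add: p_def)
  have "card (D \<inter> {1..nat \<lfloor>\<theta> * 2 ^ n\<rfloor>})
      \<le> card ((D \<inter> {1..nat \<lfloor>\<theta>' * 2 ^ n\<rfloor>}) \<union> {nat \<lfloor>\<theta>' * 2 ^ n\<rfloor><..nat \<lfloor>\<theta> * 2 ^ n\<rfloor>})"
    by (rule card_mono) auto
  also have "\<dots> \<le> card (D \<inter> {1..nat \<lfloor>\<theta>' * 2 ^ n\<rfloor>}) + (nat \<lfloor>\<theta> * 2 ^ n\<rfloor> - nat \<lfloor>\<theta>' * 2 ^ n\<rfloor>)"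
    using card_Un_le[of "D \<inter> {1..nat \<lfloor>\<theta>' * 2 ^ n\<rfloor>}" "{nat \<lfloor>\<theta>' * 2 ^ n\<rfloor><..nat \<lfloor>\<theta> * 2 ^ n\<rfloor>}"] by simp
  finally have "a \<le> b + real (nat \<lfloor>\<theta> * 2 ^ n\<rfloor> - nat \<lfloor>\<theta>' * 2 ^ n\<rfloor>)"
    unfolding a_def b_def by linarith
  moreover have "real (nat \<lfloor>\<theta> * 2 ^ n\<rfloor> - nat \<lfloor>\<theta>' * 2 ^ n\<rfloor>) \<le> \<bar>\<theta> * p - \<theta>' * p\<bar> + 1"
  proof -
    have "\<theta> * p \<ge> 0" "\<theta>' * p \<ge> 0" using \<theta> \<theta>' p by auto
    then show ?thesis unfolding p_def by linarith
  qed
  moreover have "\<bar>\<theta> * p - \<theta>' * p\<bar> = \<bar>\<theta> - \<theta>'\<bar> * p"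
    using p by (simp add: abs_mult left_diff_distrib[symmetric])
  ultimately have ab: "a \<le> b + \<bar>\<theta> - \<theta>'\<bar> * p + 1" by simp
  have b: "b \<ge> 0" and a: "a \<ge> 0" by (simp_all add: a_def b_def)
  have \<theta>p: "0 < \<theta>' * p" "1 * p \<le> \<theta>' * p" "\<theta>' * p \<le> 2 * p"
    using \<theta>' p by (auto intro: mult_right_mono)
  have "a / (\<theta> * p) / 2 \<le> a / (2 * p)"
  proof -
    have "a / (\<theta> * p) \<le> a / (1 * p)"
      by (rule divide_left_mono) (use \<theta> p a in \<open>auto intro: mult_right_mono\<close>)
    then show ?thesis by simp
  qed
  also have "\<dots> \<le> a / (\<theta>' * p)"
    by (rule divide_left_mono) (use \<theta>p p a in auto)
  also have "\<dots> \<le> (b + \<bar>\<theta> - \<theta>'\<bar> * p + 1) / (\<theta>' * p)"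
    using ab \<theta>p by (intro divide_right_mono) auto
  also have "\<dots> = b / (\<theta>' * p) + (\<bar>\<theta> - \<theta>'\<bar> * p + 1) / (\<theta>' * p)"
    by (simp add: add_divide_distrib)
  also have "(\<bar>\<theta> - \<theta>'\<bar> * p + 1) / (\<theta>' * p) \<le> (\<bar>\<theta> - \<theta>'\<bar> * p + 1) / (1 * p)"
    by (rule divide_left_mono) (use \<theta>p p in auto)
  also have "\<dots> = \<bar>\<theta> - \<theta>'\<bar> + 1 / p" using p by (simp add: field_simps)
  finally show ?thesis by (simp add: density_ratio_def a_def b_def p_def)
qed

lemma two_powr_Icc: "t \<in> {0..1} \<Longrightarrow> (2::real) powr t \<in> {1..2}"
  using powr_mono[of t 1 "2::real"] by (auto intro: ge_one_powr_ge_zero)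

text \<open>The complement is open, as can be tested on \<open>cylinder\<close> by the quotient
  topology. If the mass is \<open>c > 0\<close>, the indices with ratio above \<open>c / 2\<close>
  form a set \<open>A\<close> in the ultrafilter; all ultrafilters containing \<open>A\<close> keep
  the mass positive for nearby parameters.\<close>

lemma closedin_nu_null: "closedin Omega {\<eta> \<in> topspace Omega. nu \<eta> D = 0}"
proof -
  let ?W = "{\<eta> \<in> topspace Omega. nu \<eta> D \<noteq> 0}"
  have "openin cylinder {p \<in> topspace cylinder. pt p \<in> ?W}"
  proof (subst openin_subopen, intro ballI)
    fix p assume p: "p \<in> {p \<in> topspace cylinder. pt p \<in> ?W}"
    then obtain \<omega> t where \<omega>: "\<omega> \<in> Nstar" and t: "t \<in> {0..1}" and pe: "p = (\<omega>, t)"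
      by (auto simp: topspace_cylinder)
    define c where "c = nu (pt (\<omega>, t)) D"
    have lim: "(density_ratio (2 powr t) D \<longlongrightarrow> c) \<omega>"
      unfolding c_def by (rule nu_tendsto[OF \<omega> t])
    have "c \<ge> 0"
      by (rule tendsto_lowerbound[OF lim _ Nstar_neq_bot[OF \<omega>]])
        (use density_ratio_bounds[of "2 powr t"] in auto)
    then have c: "c > 0" using p by (simp add: c_def pe)
    define A where "A = {n. density_ratio (2 powr t) D n > c / 2}"
    \<comment> \<open>The margin \<open>c / 16\<close> is used for the parameter and again for the
      error \<open>1 / 2 ^ n\<close>: \<open>c / 4 - c / 16 - c / 16 = c / 8\<close>.\<close>
    define T where "T = {F \<in> Nstar. eventually (\<lambda>n. n \<in> A) F}
      \<times> ({u. \<bar>2 powr t - 2 powr u\<bar> < c / 16} \<inter> {0..1})"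
    have "openin (subtopology betaN Nstar) {F \<in> Nstar. eventually (\<lambda>n. n \<in> A) F}"
      unfolding openin_subtopology
      by (rule exI[of _ "{F \<in> beta_points. eventually (\<lambda>n. n \<in> A) F}"])
        (use openin_betaN_basic in \<open>auto simp: Nstar_def\<close>)
    moreover have "open {u::real. \<bar>2 powr t - 2 powr u\<bar> < c / 16}"
      by (intro open_Collect_less continuous_intros) auto
    then have "openin (top_of_set {0..1}) ({u::real. \<bar>2 powr t - 2 powr u\<bar> < c / 16} \<inter> {0..1})"
      by (metis Int_commute openin_open_Int)
    ultimately have "openin cylinder T"
      unfolding T_def cylinder_def by (simp add: openin_prod_Times_iff)
    moreover have "p \<in> T"
      using \<omega> t c order_tendstoD(1)[OF lim, of "c / 2"] by (simp add: T_def A_def pe)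
    moreover have "T \<subseteq> {p \<in> topspace cylinder. pt p \<in> ?W}"
    proof
      fix q assume "q \<in> T"
      then obtain F u where F: "F \<in> Nstar" "eventually (\<lambda>n. n \<in> A) F"
        and u: "u \<in> {0..1}" "\<bar>2 powr t - 2 powr u\<bar> < c / 16" and q: "q = (F, u)"
        by (auto simp: T_def)
      have "(\<lambda>n. 1 / 2 ^ n :: real) \<longlonglongrightarrow> 0"
        using LIMSEQ_power_zero[of "1/2 :: real"] by (simp add: power_one_over divide_simps)
      then have "((\<lambda>n. 1 / 2 ^ n :: real) \<longlongrightarrow> 0) F"
        using Nstar_le_sequentially[OF F(1)] by (rule tendsto_mono[rotated])
      then have "eventually (\<lambda>n. 1 / 2 ^ n < c / 16) F"
        by (rule order_tendstoD(2)) (use c in simp)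
      then have "eventually (\<lambda>n. c / 8 \<le> density_ratio (2 powr u) D n) F"
        using F(2)
      proof eventually_elim
        case (elim n)
        then show ?case
          using density_ratio_perturb[OF two_powr_Icc[OF t] two_powr_Icc[OF u(1)], of D n] u(2)
          unfolding A_def mem_Collect_eq by linarith
      qed
      then have "c / 8 \<le> nu (pt (F, u)) D"
        by (rule tendsto_lowerbound[OF nu_tendsto[OF F(1) u(1)] _ Nstar_neq_bot[OF F(1)]])
      then show "q \<in> {p \<in> topspace cylinder. pt p \<in> ?W}"
        using c F(1) u(1) pt_in_topspace_Omega by (auto simp: q topspace_cylinder)
    qed
    ultimately show "\<exists>T. openin cylinder T \<and> p \<in> T \<and> T \<subseteq> {p \<in> topspace cylinder. pt p \<in> ?W}"
      by blast
  qed
  then have "openin Omega ?W"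
    unfolding openin_Omega by (auto simp: topspace_Omega)
  moreover have "topspace Omega - {\<eta> \<in> topspace Omega. nu \<eta> D = 0} = ?W" by auto
  ultimately show ?thesis by (simp add: closedin_def)
qed

lemma phi_in_topspace_Omega:
  assumes "\<omega> \<in> Nstar" "t \<in> {0..1}"
  shows "phi s (pt (\<omega>, t)) \<in> topspace Omega"
proof -
  have "t + s - of_int \<lfloor>t + s\<rfloor> \<in> {0..1}" by simp linarith
  then show ?thesis
    unfolding phi_pt[OF assms] by (intro pt_in_topspace_Omega tau_pow_Nstar assms)
qed

lemma nu_null_orbit_closure:
  assumes "\<eta> \<in> topspace Omega" "nu \<eta> D = 0" "\<zeta> \<in> Omega closure_of (o_minus \<eta>)"
  shows "nu \<zeta> D = 0"
proof -
  obtain \<omega> t where \<omega>: "\<omega> \<in> Nstar" and t: "t \<in> {0..1}" and \<eta>: "\<eta> = pt (\<omega>, t)"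
    using assms(1) by (rule topspace_Omega_pt)
  have "o_minus \<eta> \<subseteq> {\<eta> \<in> topspace Omega. nu \<eta> D = 0}"
    using phi_in_topspace_Omega[OF \<omega> t] nu_phi_null[OF \<omega> t] assms(2)
    by (auto simp: o_minus_def \<eta>)
  then have "Omega closure_of (o_minus \<eta>) \<subseteq> {\<eta> \<in> topspace Omega. nu \<eta> D = 0}"
    by (rule closure_of_minimal[OF _ closedin_nu_null])
  then show ?thesis using assms(3) by auto
qed


subsection \<open>Tail filters\<close>

text \<open>The exceptional set of \<open>n\<close> may depend on the window length
  \<open>k\<close>. For free \<omega> the value of \<open>log 2 0\<close> is harmless, since each
  window of fixed length eventually lies above any given number.\<close>

definition tail_filter :: "nat filter \<Rightarrow> real \<Rightarrow> nat filter" where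
  "tail_filter \<omega> t = Abs_filter (\<lambda>P. \<forall>k::nat. eventually
     (\<lambda>n. \<forall>i::nat. real n + t - real k < log 2 i \<and> log 2 i \<le> real n + t \<longrightarrow> P i) \<omega>)"

lemma eventually_tail_filter:
  "eventually P (tail_filter \<omega> t) \<longleftrightarrow> (\<forall>k::nat. eventually
     (\<lambda>n. \<forall>i::nat. real n + t - real k < log 2 i \<and> log 2 i \<le> real n + t \<longrightarrow> P i) \<omega>)"
  unfolding tail_filter_def
proof (rule eventually_Abs_filter, rule is_filter.intro)
  fix P Q :: "nat \<Rightarrow> bool"
  assume "\<forall>k::nat. eventually (\<lambda>n. \<forall>i::nat. real n + t - real k < log 2 i \<and> log 2 i \<le> real n + t \<longrightarrow> P i) \<omega>"
    and "\<forall>k::nat. eventually (\<lambda>n. \<forall>i::nat. real n + t - real k < log 2 i \<and> log 2 i \<le> real n + t \<longrightarrow> Q i) \<omega>"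
  then have "eventually (\<lambda>n. \<forall>i::nat. real n + t - real k < log 2 i \<and> log 2 i \<le> real n + t \<longrightarrow> P i) \<omega>"
    "eventually (\<lambda>n. \<forall>i::nat. real n + t - real k < log 2 i \<and> log 2 i \<le> real n + t \<longrightarrow> Q i) \<omega>" for k :: nat
    by blast+
  then have "eventually (\<lambda>n. \<forall>i::nat. real n + t - real k < log 2 i \<and> log 2 i \<le> real n + t \<longrightarrow> P i \<and> Q i) \<omega>" for k :: nat
    by (rule eventually_elim2) blast
  then show "\<forall>k::nat. eventually (\<lambda>n. \<forall>i::nat. real n + t - real k < log 2 i \<and> log 2 i \<le> real n + t \<longrightarrow> P i \<and> Q i) \<omega>"
    by blast
next
  fix P Q :: "nat \<Rightarrow> bool"
  assume "\<forall>x. P x \<longrightarrow> Q x"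
    and "\<forall>k::nat. eventually (\<lambda>n. \<forall>i::nat. real n + t - real k < log 2 i \<and> log 2 i \<le> real n + t \<longrightarrow> P i) \<omega>"
  then show "\<forall>k::nat. eventually (\<lambda>n. \<forall>i::nat. real n + t - real k < log 2 i \<and> log 2 i \<le> real n + t \<longrightarrow> Q i) \<omega>"
    by (fast elim: eventually_mono)
qed simp

lemma tail_filter_log_ge:
  assumes "\<omega> \<in> Nstar" "0 \<le> t"
  shows "eventually (\<lambda>i. real m \<le> log 2 i) (tail_filter \<omega> t)"
  unfolding eventually_tail_filter
proof
  fix k :: nat
  show "eventually (\<lambda>n. \<forall>i::nat. real n + t - real k < log 2 i \<and> log 2 i \<le> real n + t \<longrightarrow> m \<le> log 2 i) \<omega>"
    using Nstar_eventually_ge[OF assms(1), of "m + k"]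
    by eventually_elim (use assms(2) in auto)
qed

text \<open>If \<open>D\<close> misses the window of length \<open>k\<close>, its elements up to
  \<open>2 powr (n + t)\<close> are at most \<open>2 powr (n + t - k)\<close>, a proportion of at
  most \<open>(1 / 2) ^ k\<close>. This holds for every \<open>k\<close>.\<close>

lemma nu_null_tail_filter:
  assumes \<omega>: "\<omega> \<in> Nstar" and t: "t \<in> {0..1}" and D: "eventually (\<lambda>i. i \<notin> D) (tail_filter \<omega> t)"
  shows "nu (pt (\<omega>, t)) D = 0"
proof -
  have lim: "(density_ratio (2 powr t) D \<longlongrightarrow> nu (pt (\<omega>, t)) D) \<omega>"
    by (rule nu_tendsto[OF \<omega> t])
  have le: "nu (pt (\<omega>, t)) D \<le> (1 / 2) ^ k" for k
  proof (rule tendsto_upperbound[OF lim _ Nstar_neq_bot[OF \<omega>]])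
    have "eventually (\<lambda>n. \<forall>i::nat. real n + t - real k < log 2 i \<and> log 2 i \<le> real n + t \<longrightarrow> i \<notin> D) \<omega>"
      using D by (simp add: eventually_tail_filter)
    then show "eventually (\<lambda>n. density_ratio (2 powr t) D n \<le> (1 / 2) ^ k) \<omega>"
    proof eventually_elim
      case (elim n)
      have pow: "2 powr t * 2 ^ n = (2::real) powr (real n + t)"
        by (simp add: powr_add powr_realpow)
      have sub: "D \<inter> {1..nat \<lfloor>2 powr t * 2 ^ n\<rfloor>} \<subseteq> {1..nat \<lfloor>(2::real) powr (real n + t - real k)\<rfloor>}"
      proof
        fix i assume i: "i \<in> D \<inter> {1..nat \<lfloor>2 powr t * 2 ^ n\<rfloor>}"
        then have "real i \<le> 2 powr (real n + t)" unfolding pow[symmetric] by (simp add: le_nat_iff le_floor_iff)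
        then have "log 2 i \<le> real n + t" using i by (simp add: log_le_iff)
        then have "log 2 i \<le> real n + t - real k" using elim i by force
        then have "real i \<le> 2 powr (real n + t - real k)" using i by (simp add: log_le_iff)
        then show "i \<in> {1..nat \<lfloor>(2::real) powr (real n + t - real k)\<rfloor>}"
          using i by (simp add: le_nat_iff le_floor_iff)
      qed
      have "card (D \<inter> {1..nat \<lfloor>2 powr t * 2 ^ n\<rfloor>}) \<le> nat \<lfloor>(2::real) powr (real n + t - real k)\<rfloor>"
        using card_mono[OF _ sub] by simp
      then have "real (card (D \<inter> {1..nat \<lfloor>2 powr t * 2 ^ n\<rfloor>})) \<le> 2 powr (real n + t - real k)"
        by (smt (verit) of_nat_floor of_nat_mono powr_ge_zero)
      also have "\<dots> = (1 / 2) ^ k * (2 powr t * 2 ^ n)"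
        unfolding pow by (simp add: powr_diff powr_realpow power_one_over)
      finally show ?case by (simp add: density_ratio_def divide_le_eq)
    qed
  qed
  have "(\<lambda>k. (1 / 2) ^ k :: real) \<longlonglongrightarrow> 0" by (intro LIMSEQ_power_zero) simp
  then have "nu (pt (\<omega>, t)) D \<le> 0"
    by (rule tendsto_lowerbound) (use le in auto)
  moreover have "0 \<le> nu (pt (\<omega>, t)) D"
    by (rule tendsto_lowerbound[OF lim _ Nstar_neq_bot[OF \<omega>]])
      (use density_ratio_bounds[of "2 powr t"] in auto)
  ultimately show ?thesis by simp
qed

text \<open>
  The length of the window is bounded, so the backward orbit meets only finitely many translates of
  \<open>\<omega>\<close> there; this makes the exceptional set of indices uniform in the flow time.
\<close>

lemma tail_filter_avoid:
  assumes \<omega>: "\<omega> \<in> Nstar" and t: "t \<in> {0..1}"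
    and avoid: "\<And>s. s \<ge> 0 \<Longrightarrow> \<bar>frac (t - s) - t0\<bar> < \<delta> \<Longrightarrow>
      \<not> eventually (\<lambda>n. n \<in> A) (tau_pow \<lfloor>t - s\<rfloor> \<omega>)"
  shows "eventually (\<lambda>i. \<not> (nat \<lfloor>log 2 i\<rfloor> \<in> A \<and> \<bar>frac (log 2 i) - t0\<bar> < \<delta>)) (tail_filter \<omega> t)"
  unfolding eventually_tail_filter
proof
  fix k :: nat
  \<comment> \<open>Integer parts of \<open>t - s\<close> for flow times \<open>s\<close> below
    \<open>k\<close>, kept only when the fractional part is near \<open>t0\<close>; the range is
    generous, and only finiteness matters.\<close>
  define J where "J = {j \<in> {- int k - 1..1}. \<exists>s\<ge>0. \<lfloor>t - s\<rfloor> = j \<and> \<bar>frac (t - s) - t0\<bar> < \<delta>}"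
  have fin: "finite J"
    unfolding J_def by (rule finite_subset[of _ "{- int k - 1..1}"]) auto
  have "eventually (\<lambda>n. nat (int n + j) \<notin> A) \<omega>" if "j \<in> J" for j
  proof -
    have "\<not> eventually (\<lambda>n. n \<in> A) (tau_pow j \<omega>)"
      using that avoid by (auto simp: J_def)
    then show ?thesis
      using ultrafilter_not_eventually[OF Nstar_ultrafilter[OF \<omega>], of "\<lambda>n. nat (int n + j) \<in> A"]
      by (simp add: eventually_tau_pow[OF \<omega>])
  qed
  then have "eventually (\<lambda>n. \<forall>j\<in>J. nat (int n + j) \<notin> A) \<omega>"
    by (intro eventually_ball_finite fin) auto
  then show "eventually (\<lambda>n. \<forall>i::nat. real n + t - real k < log 2 i \<and> log 2 i \<le> real n + t \<longrightarrow>
      \<not> (nat \<lfloor>log 2 i\<rfloor> \<in> A \<and> \<bar>frac (log 2 i) - t0\<bar> < \<delta>)) \<omega>"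
  proof eventually_elim
    case (elim n)
    show ?case
    proof (intro allI impI notI)
      fix i :: nat
      assume i: "real n + t - real k < log 2 i \<and> log 2 i \<le> real n + t"
        and bad: "nat \<lfloor>log 2 i\<rfloor> \<in> A \<and> \<bar>frac (log 2 i) - t0\<bar> < \<delta>"
      \<comment> \<open>The flow time leading from position \<open>n + t\<close> down to
        \<open>log 2 i\<close>; integer parts then differ by \<open>n\<close> and fractional parts
        agree.\<close>
      define s where "s = real n + t - log 2 i"
      have log: "log 2 i = of_int (int n) + (t - s)" by (simp add: s_def)
      have fl: "\<lfloor>log 2 i\<rfloor> = int n + \<lfloor>t - s\<rfloor>" unfolding log by linarith
      have "frac (log 2 i) = frac (t - s)" unfolding frac_def fl by (simp add: log)
      moreover have "s \<ge> 0" "s < k" using i by (auto simp: s_def)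
      moreover from this have "- int k - 1 \<le> \<lfloor>t - s\<rfloor>" "\<lfloor>t - s\<rfloor> \<le> 1"
        using t by (simp_all add: le_floor_iff floor_le_iff)
      ultimately have "\<lfloor>t - s\<rfloor> \<in> J" using bad by (auto simp: J_def)
      then show False using elim bad by (simp add: fl)
    qed
  qed
qed

section \<open>From tail filters to points of orbit closures\<close>

text \<open>A neighbourhood of the point contains a box given by a set \<open>A\<close> and a radius
  \<delta>. If the backward orbit missed it, \<open>tail_filter_avoid\<close> would make
  \<open>H\<close> avoid the box in logarithmic coordinates, whereas \<open>H\<close> concentrates
  there.\<close>

lemma orbit_closure_tail_filter:
  assumes \<omega>: "\<omega> \<in> Nstar" and t: "t \<in> {0..1}"
    and H: "H \<noteq> bot" "H \<le> tail_filter \<omega> t"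
    and \<omega>0: "filtermap (\<lambda>i. nat \<lfloor>log 2 i\<rfloor>) H \<in> Nstar" and t0: "t0 \<in> {0..1}"
    and lim: "((\<lambda>i. frac (log 2 i)) \<longlongrightarrow> t0) H"
  shows "pt (filtermap (\<lambda>i. nat \<lfloor>log 2 i\<rfloor>) H, t0) \<in> Omega closure_of (o_minus (pt (\<omega>, t)))"
  unfolding in_closure_of
proof (intro conjI allI impI)
  let ?\<omega>0 = "filtermap (\<lambda>i::nat. nat \<lfloor>log 2 i\<rfloor>) H"
  show "pt (?\<omega>0, t0) \<in> topspace Omega" by (rule pt_in_topspace_Omega[OF \<omega>0 t0])
  fix W assume W: "pt (?\<omega>0, t0) \<in> W \<and> openin Omega W"
  then have "openin cylinder {p \<in> topspace cylinder. pt p \<in> W}" by (simp add: openin_Omega)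
  moreover have "(?\<omega>0, t0) \<in> {p \<in> topspace cylinder. pt p \<in> W}"
    using W \<omega>0 t0 by (simp add: topspace_cylinder)
  ultimately obtain U V where U: "openin (subtopology betaN Nstar) U" "?\<omega>0 \<in> U"
    and V: "openin (top_of_set {0..1}) V" "t0 \<in> V"
    and UV: "U \<times> V \<subseteq> {p \<in> topspace cylinder. pt p \<in> W}"
    unfolding cylinder_def openin_prod_topology_alt by blast
  obtain T where T: "openin betaN T" "U = T \<inter> Nstar" using U(1) by (auto simp: openin_subtopology)
  obtain A where A: "eventually (\<lambda>n. n \<in> A) ?\<omega>0"
    "\<And>F. F \<in> beta_points \<Longrightarrow> eventually (\<lambda>n. n \<in> A) F \<Longrightarrow> F \<in> T"
    using openin_betaN_neighbourhood[OF T(1), of ?\<omega>0] U(2) T(2) by blast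
  obtain \<delta> where \<delta>: "\<delta> > 0" "\<And>u. u \<in> {0..1} \<Longrightarrow> \<bar>u - t0\<bar> < \<delta> \<Longrightarrow> u \<in> V"
    using V unfolding openin_euclidean_subtopology_iff by (metis dist_real_def)
  show "\<exists>\<zeta>. \<zeta> \<in> o_minus (pt (\<omega>, t)) \<and> \<zeta> \<in> W"
  proof (rule ccontr)
    assume none: "\<not> ?thesis"
    have "eventually (\<lambda>i. \<not> (nat \<lfloor>log 2 i\<rfloor> \<in> A \<and> \<bar>frac (log 2 i) - t0\<bar> < \<delta>)) (tail_filter \<omega> t)"
    proof (rule tail_filter_avoid[OF \<omega> t], rule notI)
      fix s :: real
      assume s: "s \<ge> 0" "\<bar>frac (t - s) - t0\<bar> < \<delta>" "eventually (\<lambda>n. n \<in> A) (tau_pow \<lfloor>t - s\<rfloor> \<omega>)"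
      have "tau_pow \<lfloor>t - s\<rfloor> \<omega> \<in> U"
        using A(2) s(3) tau_pow_Nstar(1)[OF \<omega>] by (auto simp: T(2) Nstar_def)
      moreover have "frac (t - s) \<in> V"
        by (rule \<delta>(2)) (use s(2) in \<open>auto simp: frac_lt_1 less_imp_le\<close>)
      ultimately have "pt (tau_pow \<lfloor>t - s\<rfloor> \<omega>, frac (t - s)) \<in> W" using UV by blast
      then have "phi (- s) (pt (\<omega>, t)) \<in> W"
        by (simp add: phi_pt[OF \<omega> t] frac_def)
      then show False using none s(1) by (auto simp: o_minus_def)
    qed
    then have "eventually (\<lambda>i. \<not> (nat \<lfloor>log 2 i\<rfloor> \<in> A \<and> \<bar>frac (log 2 i) - t0\<bar> < \<delta>)) H"
      using H(2) filter_leD by blast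
    moreover have "eventually (\<lambda>i. nat \<lfloor>log 2 i\<rfloor> \<in> A) H"
      using A(1) by (simp add: eventually_filtermap)
    moreover have "eventually (\<lambda>i. \<bar>frac (log 2 i) - t0\<bar> < \<delta>) H"
      using tendstoD[OF lim \<delta>(1)] by (simp add: dist_real_def)
    ultimately have "eventually (\<lambda>i. False) H" by eventually_elim simp
    then show False using H(1) by (simp add: trivial_limit_def)
  qed
qed

text \<open>The limit point is computed from \<open>H\<close> alone, and \<open>H\<close> refines
  both tail filters, so the same point lies in both closures.\<close>

lemma tail_filters_meet_orbit_closures:
  assumes \<omega>: "\<omega> \<in> Nstar" "t \<in> {0..1}" and \<omega>': "\<omega>' \<in> Nstar" "t' \<in> {0..1}"
    and meet: "inf (tail_filter \<omega> t) (tail_filter \<omega>' t') \<noteq> bot"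
  shows "(Omega closure_of (o_minus (pt (\<omega>, t)))) \<inter> (Omega closure_of (o_minus (pt (\<omega>', t')))) \<noteq> {}"
proof -
  obtain H where H: "ultrafilter H" "H \<le> inf (tail_filter \<omega> t) (tail_filter \<omega>' t')"
    using ultrafilter_exists[OF meet] by blast
  have bot: "H \<noteq> bot" using H(1) by (simp add: ultrafilter_def)
  have le: "H \<le> tail_filter \<omega> t" "H \<le> tail_filter \<omega>' t'" using H(2) by auto
  let ?\<omega>0 = "filtermap (\<lambda>i::nat. nat \<lfloor>log 2 i\<rfloor>) H"
  have "eventually (\<lambda>n. m \<le> n) ?\<omega>0" for m
  proof -
    have "eventually (\<lambda>i. real m \<le> log 2 i) H"
      using tail_filter_log_ge[of \<omega> t m] \<omega> le(1) filter_leD by auto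
    then show ?thesis unfolding eventually_filtermap
      by eventually_elim (simp add: le_nat_iff le_floor_iff)
  qed
  then have "?\<omega>0 \<le> sequentially"
    unfolding le_sequentially by simp
  then have \<omega>0: "?\<omega>0 \<in> Nstar" by (simp add: Nstar_iff ultrafilter_filtermap H(1))
  have frac01: "frac (log 2 (real i)) \<in> {0..1}" for i
    by (simp add: frac_lt_1 less_imp_le)
  obtain t0 where t0: "((\<lambda>i. frac (log 2 (real i))) \<longlongrightarrow> t0) H"
    using ultrafilter_tendsto[OF H(1), of "\<lambda>i. frac (log 2 (real i))", OF frac01] by blast
  \<comment> \<open>The limit may be 1 although fractional parts stay below 1; the closed interval
    in \<open>cylinder\<close> accommodates this.\<close>
  have "t0 \<in> {0..1}"
    using tendsto_lowerbound[OF t0 _ bot, of 0] tendsto_upperbound[OF t0 _ bot, of 1] frac01 by auto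
  then show ?thesis
    using orbit_closure_tail_filter[OF \<omega> bot le(1) \<omega>0 _ t0]
      orbit_closure_tail_filter[OF \<omega>' bot le(2) \<omega>0 _ t0] by blast
qed

section \<open>Strong singularity against disjointness of orbit closures\<close>

theorem theorem3p9:
  fixes \<eta> \<eta>' :: "(nat filter \<times> real) set"
  assumes "\<eta> \<in> topspace Omega" and "\<eta>' \<in> topspace Omega"
  shows "strongly_singular (nu \<eta>) (nu \<eta>') \<longleftrightarrow>
    (Omega closure_of (o_minus \<eta>)) \<inter> (Omega closure_of (o_minus \<eta>')) = {}"
proof
  assume "strongly_singular (nu \<eta>) (nu \<eta>')"
  then obtain D where D: "D \<subseteq> {1..}" "nu \<eta> D = 0" "nu \<eta>' ({1..} - D) = 0"
    by (auto simp: strongly_singular_def)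
  show "(Omega closure_of (o_minus \<eta>)) \<inter> (Omega closure_of (o_minus \<eta>')) = {}"
  proof (rule equals0I)
    fix \<zeta> assume \<zeta>: "\<zeta> \<in> (Omega closure_of (o_minus \<eta>)) \<inter> (Omega closure_of (o_minus \<eta>'))"
    \<comment> \<open>Each null set is inherited from a different orbit, yet the two sets partition
      \<open>{1..}\<close>, which has mass 1.\<close>
    then have 0: "nu \<zeta> D = 0" "nu \<zeta> ({1..} - D) = 0"
      using nu_null_orbit_closure assms D by blast+
    have fap: "fin_add_prob (nu \<zeta>)"
      using \<zeta> closure_of_subset_topspace by (intro nu_fin_add_prob) fast
    have "nu \<zeta> (D \<union> ({1..} - D)) = nu \<zeta> D + nu \<zeta> ({1..} - D)"
      by (rule fap[unfolded fin_add_prob_def, THEN conjunct2, THEN conjunct2, rule_format]) (use D(1) in auto)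
    moreover have "nu \<zeta> {1..} = 1" using fap by (simp add: fin_add_prob_def)
    moreover have "D \<union> ({1..} - D) = {1..}" using D(1) by auto
    ultimately show False using 0 by simp
  qed
next
  assume disj: "(Omega closure_of (o_minus \<eta>)) \<inter> (Omega closure_of (o_minus \<eta>')) = {}"
  obtain \<omega> t where \<omega>: "\<omega> \<in> Nstar" "t \<in> {0..1}" and \<eta>: "\<eta> = pt (\<omega>, t)"
    using assms(1) by (rule topspace_Omega_pt)
  obtain \<omega>' t' where \<omega>': "\<omega>' \<in> Nstar" "t' \<in> {0..1}" and \<eta>': "\<eta>' = pt (\<omega>', t')"
    using assms(2) by (rule topspace_Omega_pt)
  have "inf (tail_filter \<omega> t) (tail_filter \<omega>' t') = bot"
    using tail_filters_meet_orbit_closures[OF \<omega> \<omega>'] disj by (auto simp: \<eta> \<eta>')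
  then have "eventually (\<lambda>i. False) (inf (tail_filter \<omega> t) (tail_filter \<omega>' t'))" by simp
  then obtain P Q where PQ: "eventually P (tail_filter \<omega> t)" "eventually Q (tail_filter \<omega>' t')"
    "\<And>i. \<not> (P i \<and> Q i)"
    unfolding eventually_inf by blast
  \<comment> \<open>The tail of \<eta> lies in \<open>P\<close> and so misses \<open>D\<close>; the
    tail of \<open>\<eta>'\<close> lies in \<open>Q\<close>, which is disjoint from
    \<open>P\<close>, and so misses \<open>{1..} - D\<close>.\<close>
  define D where "D = {i \<in> {1..}. \<not> P i}"
  have "nu \<eta> D = 0"
    unfolding \<eta>
    by (rule nu_null_tail_filter[OF \<omega>], rule eventually_mono[OF PQ(1)]) (auto simp: D_def)
  moreover have "nu \<eta>' ({1..} - D) = 0"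
    unfolding \<eta>'
    by (rule nu_null_tail_filter[OF \<omega>'], rule eventually_mono[OF PQ(2)]) (use PQ(3) in \<open>auto simp: D_def\<close>)
  moreover have "D \<subseteq> {1..}" by (auto simp: D_def)
  ultimately show "strongly_singular (nu \<eta>) (nu \<eta>')"
    unfolding strongly_singular_def by blast
qed

end
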